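(* Let $f:X\to Y$ and $g:Y\to Z$ be continuous maps of topological spaces, let $B\subseteq X$, and suppose that $g$ is injective on $f(B)$. Then $TC^P(f,B)\le TC^P(gf,B)$.
   Context: For a topological space $X$, $PX=X^I$ is the space of continuous paths $[0,1]\to X$ with the compact-open topology. For $B\subseteq X$, $P_{X\times B}=\{\gamma\in PX : \gamma(1)\in B\}$ (subspace topology). For a continuous map $f:X\to Y$ and $B\subseteq X$, let $\pi_{f(B)}:P_{X\times B}\to X\times f(B)$, $\pi_{f(B)}(\gamma)=(\gamma(0),f(\gamma(1)))$. The targeted complexity $TC^P(f,B)$ is the least integer $n\ge 0$ such that there is an open cover $U_0,\dots,U_n$ of $X\times f(B)$ with, for each $i$, a continuous partial section $s_i:U_i\to P_{X\times B}$, i.e. $\pi_{f(B)}s_i=\mathrm{id}_{U_i}$; if no such $n$ exists, $TC^P(f,B)=\infty$. *)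

theory Defs
  imports "HOL-Analysis.Analysis" "HOL-Library.Extended_Nat"
begin

(* Spaces are abstract topologies 'a topology, whose points form topspace X.  A continuous map
   S -> T is represented by its unique representative that is undefined outside topspace S
   (extensional), so that equality of representatives is equality of maps. *)

definition continuous_maps :: "'a topology \<Rightarrow> 'b topology \<Rightarrow> ('a \<Rightarrow> 'b) set" where
  "continuous_maps S T = {h. continuous_map S T h \<and> h \<in> extensional (topspace S)}"

definition compact_open_topology :: "'a topology \<Rightarrow> 'b topology \<Rightarrow> ('a \<Rightarrow> 'b) topology" where
  "compact_open_topology S T =
     topology_generated_by
       {{h \<in> continuous_maps S T. h ` K \<subseteq> V} | K V. compactin S K \<and> openin T V}"

lemma topspace_compact_open_topology [simp]:
  "topspace (compact_open_topology S T) = continuous_maps S T"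
proof -
  have "continuous_maps S T \<in>
      {{h \<in> continuous_maps S T. h ` K \<subseteq> V} | K V. compactin S K \<and> openin T V}"
    by (rule CollectI, rule exI[of _ "{}"], rule exI[of _ "{}"]) auto
  then show ?thesis
    unfolding compact_open_topology_def topology_generated_by_topspace by blast
qed

definition path_space :: "'a topology \<Rightarrow> (real \<Rightarrow> 'a) topology" where
  "path_space X = compact_open_topology (top_of_set {0..1}) X"

lemma topspace_path_space [simp]:
  "topspace (path_space X) = {\<gamma>. pathin X \<gamma> \<and> \<gamma> \<in> extensional {0..1}}"
  by (simp add: path_space_def continuous_maps_def pathin_def)

definition path_space_into :: "'a topology \<Rightarrow> 'a set \<Rightarrow> (real \<Rightarrow> 'a) topology" where
  "path_space_into X B = subtopology (path_space X) {\<gamma>. \<gamma> 1 \<in> B}"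

definition target_map :: "('a \<Rightarrow> 'b) \<Rightarrow> (real \<Rightarrow> 'a) \<Rightarrow> 'a \<times> 'b" where
  "target_map f \<gamma> = (\<gamma> 0, f (\<gamma> 1))"

definition target_space :: "'a topology \<Rightarrow> 'b topology \<Rightarrow> ('a \<Rightarrow> 'b) \<Rightarrow> 'a set \<Rightarrow> ('a \<times> 'b) topology" where
  "target_space X Y f B = prod_topology X (subtopology Y (f ` B))"

lemma target_map_in_target_space:
  assumes "continuous_map X Y f" "\<gamma> \<in> topspace (path_space_into X B)"
  shows "target_map f \<gamma> \<in> topspace (target_space X Y f B)"
  using assms
  by (auto simp: target_space_def path_space_into_def target_map_def pathin_def
      continuous_map_def Pi_iff)

definition has_motion_planner ::
  "'a topology \<Rightarrow> 'b topology \<Rightarrow> ('a \<Rightarrow> 'b) \<Rightarrow> 'a set \<Rightarrow> ('a \<times> 'b) set \<Rightarrow> bool" where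
  "has_motion_planner X Y f B U \<longleftrightarrow>
     (\<exists>s. continuous_map (subtopology (target_space X Y f B) U) (path_space_into X B) s \<and>
          (\<forall>p\<in>U. target_map f (s p) = p))"

definition has_motion_planning_cover ::
  "'a topology \<Rightarrow> 'b topology \<Rightarrow> ('a \<Rightarrow> 'b) \<Rightarrow> 'a set \<Rightarrow> nat \<Rightarrow> bool" where
  "has_motion_planning_cover X Y f B n \<longleftrightarrow>
     (\<exists>U :: nat \<Rightarrow> ('a \<times> 'b) set.
        (\<forall>i\<le>n. openin (target_space X Y f B) (U i) \<and> has_motion_planner X Y f B (U i)) \<and>
        (\<Union>i\<le>n. U i) = topspace (target_space X Y f B))"

(* In enat, Inf {} = \<infinity>, and the infimum of a nonempty set is its least element. *)
definition targeted_complexity ::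
  "'a topology \<Rightarrow> 'b topology \<Rightarrow> ('a \<Rightarrow> 'b) \<Rightarrow> 'a set \<Rightarrow> enat" where
  "targeted_complexity X Y f B = Inf {enat n | n. has_motion_planning_cover X Y f B n}"

end

theory Submission
  imports Defs
begin

text \<open>
  The map \<open>id \<times> g\<close> carries \<open>X \<times> f(B)\<close> continuously to \<open>X \<times> gf(B)\<close>, so open covers and
  partial sections for \<open>gf\<close> pull back along it. A pulled-back section \<open>s\<close> sends \<open>(x, y)\<close> to a path
  \<open>\<gamma>\<close> from \<open>x\<close> into \<open>B\<close> with \<open>g(f(\<gamma>(1))) = g(y)\<close>; since \<open>y\<close> and \<open>f(\<gamma>(1))\<close> both lie in \<open>f(B)\<close>,
  where \<open>g\<close> is injective, \<open>f(\<gamma>(1)) = y\<close>, and the pulled-back map is a section for \<open>f\<close>. Every cover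
  counted by the complexity of \<open>gf\<close> therefore gives one of the same length for \<open>f\<close>.
\<close>

lemma continuous_map_target_space:
  assumes "continuous_map Y Z g"
  shows "continuous_map (target_space X Y f B) (target_space X Z (g \<circ> f) B) (apsnd g)"
proof -
  have "continuous_map (subtopology Y (f ` B)) (subtopology Z ((g \<circ> f) ` B)) g"
    using assms
    by (auto simp: continuous_map_in_subtopology continuous_map_from_subtopology)
  then have "continuous_map (target_space X Y f B) (target_space X Z (g \<circ> f) B)
      (\<lambda>(x, y). (x, g y))"
    unfolding target_space_def by (simp add: continuous_map_prod_top)
  then show ?thesis
    by (simp add: apsnd_def map_prod_def)
qed

text \<open>
  Injectivity enters here: composing with \<open>g\<close> loses nothing about endpoints in \<open>f(B)\<close>, so the section equation for \<open>gf\<close> can be cancelled to the one for \<open>f\<close>.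
\<close>

lemma has_motion_planner_pullback:
  assumes "continuous_map Y Z g" and "inj_on g (f ` B)"
    and "has_motion_planner X Z (g \<circ> f) B V"
  defines "U \<equiv> {p \<in> topspace (target_space X Y f B). apsnd g p \<in> V}"
  shows "has_motion_planner X Y f B U"
proof -
  obtain s where s: "continuous_map (subtopology (target_space X Z (g \<circ> f) B) V)
        (path_space_into X B) s"
    and sect: "\<And>q. q \<in> V \<Longrightarrow> target_map (g \<circ> f) (s q) = q"
    using assms(3) unfolding has_motion_planner_def by blast
  have G: "continuous_map (subtopology (target_space X Y f B) U)
      (subtopology (target_space X Z (g \<circ> f) B) V) (apsnd g)"
    using continuous_map_from_subtopology[OF continuous_map_target_space[OF assms(1)]]
    by (auto simp: continuous_map_in_subtopology U_def)
  have sG: "continuous_map (subtopology (target_space X Y f B) U) (path_space_into X B)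
      (s \<circ> apsnd g)"
    by (rule continuous_map_compose[OF G s])
  have "target_map f ((s \<circ> apsnd g) p) = p" if "p \<in> U" for p
  proof -
    let ?\<gamma> = "s (apsnd g p)"
    have p: "p \<in> topspace (target_space X Y f B)" and "apsnd g p \<in> V"
      using that by (auto simp: U_def)
    then have eq: "?\<gamma> 0 = fst p" "g (f (?\<gamma> 1)) = g (snd p)"
      using sect[of "apsnd g p"] by (auto simp: target_map_def prod_eq_iff)
    have "?\<gamma> \<in> topspace (path_space_into X B)"
      using continuous_map_image_subset_topspace[OF sG] p that by auto
    then have "f (?\<gamma> 1) \<in> f ` B"
      by (simp add: path_space_into_def)
    moreover have "snd p \<in> f ` B"
      using p by (auto simp: target_space_def)
    ultimately have "f (?\<gamma> 1) = snd p"
      using eq(2) assms(2) by (simp add: inj_on_eq_iff)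
    with eq(1) show ?thesis
      by (simp add: target_map_def)
  qed
  with sG show ?thesis
    unfolding has_motion_planner_def by blast
qed

lemma has_motion_planning_cover_pullback:
  assumes "continuous_map Y Z g" and "inj_on g (f ` B)"
    and "has_motion_planning_cover X Z (g \<circ> f) B n"
  shows "has_motion_planning_cover X Y f B n"
proof -
  obtain V where V: "\<And>i. i \<le> n \<Longrightarrow> openin (target_space X Z (g \<circ> f) B) (V i)"
      "\<And>i. i \<le> n \<Longrightarrow> has_motion_planner X Z (g \<circ> f) B (V i)"
    and cover: "(\<Union>i\<le>n. V i) = topspace (target_space X Z (g \<circ> f) B)"
    using assms(3) unfolding has_motion_planning_cover_def by blast
  define U where "U i = {p \<in> topspace (target_space X Y f B). apsnd g p \<in> V i}" for i
  note G = continuous_map_target_space[OF assms(1)]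
  have "openin (target_space X Y f B) (U i)" if "i \<le> n" for i
    unfolding U_def by (rule openin_continuous_map_preimage[OF G V(1)[OF that]])
  moreover have "has_motion_planner X Y f B (U i)" if "i \<le> n" for i
    unfolding U_def by (rule has_motion_planner_pullback[OF assms(1,2) V(2)[OF that]])
  moreover have "(\<Union>i\<le>n. U i) = topspace (target_space X Y f B)"
  proof
    show "topspace (target_space X Y f B) \<subseteq> (\<Union>i\<le>n. U i)"
    proof
      fix p assume p: "p \<in> topspace (target_space X Y f B)"
      then have "apsnd g p \<in> (\<Union>i\<le>n. V i)"
        unfolding cover using continuous_map_image_subset_topspace[OF G] by blast
      with p show "p \<in> (\<Union>i\<le>n. U i)"
        by (auto simp: U_def)
    qed
  qed (auto simp: U_def)
  ultimately show ?thesis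
    unfolding has_motion_planning_cover_def by blast
qed

theorem proposition3p3:
  fixes X :: "'a topology" and Y :: "'b topology" and Z :: "'c topology"
    and f :: "'a \<Rightarrow> 'b" and g :: "'b \<Rightarrow> 'c" and B :: "'a set"
  assumes "continuous_map X Y f"
    and "continuous_map Y Z g"
    and "B \<subseteq> topspace X"
    and "inj_on g (f ` B)"
  shows "targeted_complexity X Y f B \<le> targeted_complexity X Z (g \<circ> f) B"
  unfolding targeted_complexity_def
  using has_motion_planning_cover_pullback[OF assms(2,4)]
  by (intro Inf_superset_mono) blast

end
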